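(* For every integer $t\ge1$, there are an integer $n$ and, with $G=\mathbb F_2^n$, equal-size subspaces $H_0,H_1\le G$ and one nonempty set $B\subseteq G$ such that $$|H_i+H_i|=|H_i|,\qquad |H_i\triangle B|=(1-2^{-t})|H_i|\qquad(i\in\{0,1\}),$$ and $$\min_{\substack{V\le G\\ |V|\le|H_0|}}\ \max\left\{\mathcal N_V(H_0),\mathcal N_V(H_1)\right\}=2^{\lceil t/2\rceil},$$ where the minimum is over subspaces $V\leq G$ with $|V|\le|H_0|$.
   Context: For $S,T\subseteq\mathbb F_2^n$, $S+T=\{s+t:s\in S,t\in T\}$; $\triangle$ is symmetric difference. For a subspace $V\le\mathbb F_2^n$ and a set $S$, $\mathcal N_V(S)=\min\{|T|:S\subseteq T+V\}$ is the minimum number of $V$-cosets needed to cover $S$. *)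

theory Defs
  imports
    Complex_Main
    "HOL-Library.Z2"
    "HOL-Library.Set_Algebras"
    "Jordan_Normal_Form.VS_Connect"
begin

(* Vectors carry their dimension as data, so n can be quantified; on subsets of
   carrier_vec n, + is the sumset of Set_Algebras with componentwise addition. *)
abbreviation F2_space :: "nat \<Rightarrow> bit vec set" where
  "F2_space n \<equiv> carrier_vec n"

abbreviation F2_subspace :: "nat \<Rightarrow> bit vec set \<Rightarrow> bool" where
  "F2_subspace n V \<equiv> VectorSpace.subspace class_ring V (module_vec TYPE(bit) n)"

definition coset_cover_num :: "nat \<Rightarrow> bit vec set \<Rightarrow> bit vec set \<Rightarrow> nat" where
  "coset_cover_num n V S = Min {card T | T. T \<subseteq> F2_space n \<and> S \<subseteq> T + V}"

lemma finite_F2_space: "finite (F2_space n)"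
proof -
  have "inj_on list_of_vec (F2_space n)"
    by (rule inj_onI) (metis vec_list)
  moreover have "list_of_vec ` F2_space n \<subseteq> {xs. set xs \<subseteq> {0, 1} \<and> length xs = n}"
    by auto
  moreover have "finite {xs. set xs \<subseteq> {0, 1 :: bit} \<and> length xs = n}"
    by (rule finite_lists_length_eq) simp
  ultimately show ?thesis
    by (meson finite_imageD finite_subset)
qed

(* The minimum defining coset_cover_num is over a finite nonempty set. *)
lemma coset_cover_num_set:
  assumes "F2_subspace n V" and "S \<subseteq> F2_space n"
  shows "finite {card T | T. T \<subseteq> F2_space n \<and> S \<subseteq> T + V}"
    and "{card T | T. T \<subseteq> F2_space n \<and> S \<subseteq> T + V} \<noteq> {}"
proof -
  show "finite {card T | T. T \<subseteq> F2_space n \<and> S \<subseteq> T + V}"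
  proof (rule finite_subset)
    show "{card T | T. T \<subseteq> F2_space n \<and> S \<subseteq> T + V} \<subseteq> card ` Pow (F2_space n)"
      by blast
  qed (simp add: finite_F2_space)
  have "submodule class_ring V (module_vec TYPE(bit) n)"
    using assms(1) by (rule VectorSpace.subspace.submod)
  then have zero: "0\<^sub>v n \<in> V"
    by (metis submodule.zero_closed module_vec_simps(2))
  have "S \<subseteq> S + V"
  proof
    fix x assume x: "x \<in> S"
    then have "x + 0\<^sub>v n = x"
      using assms(2) by (intro right_zero_vec) (rule subsetD)
    with set_plus_intro[OF x zero] show "x \<in> S + V" by simp
  qed
  with assms(2) show "{card T | T. T \<subseteq> F2_space n \<and> S \<subseteq> T + V} \<noteq> {}"
    by auto
qed

end

(* In G = F_2^(2t) take the complementary coordinate subspaces H_0 = F_2^t x 0 and H_1 = 0 x F_2^t,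
   and B = {0}. A cover of H_i by cosets of V needs at least |H_i| / |V \<inter> H_i| cosets, and
   |V \<inter> H_0| |V \<inter> H_1| \<le> |V| \<le> 2^t because H_0 \<inter> H_1 = 0. Both factors are powers of two, so the
   smaller one is at most 2^(floor (t/2)). Splitting the t coordinates of V evenly between H_0 and H_1
   attains the bound. *)
theory Submission
  imports Defs
begin

(* These rules would rewrite inside the scalar ring, out of shape with the facts about F2_subspace. *)
declare add_bit_eq_xor [simp del] mult_bit_eq_and [simp del]

section \<open>Subspaces of binary vector spaces\<close>

text \<open>The only scalars of \<open>bit\<close> are 0 and 1, so closure under scaling already
  follows from \<open>0\<^sub>v n \<in> V\<close>. All later subspace goals reduce to this
  criterion.\<close>

lemma F2_subspace_iff:
  "F2_subspace n V \<longleftrightarrow>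
    V \<subseteq> F2_space n \<and> 0\<^sub>v n \<in> V \<and> (\<forall>u\<in>V. \<forall>v\<in>V. u + v \<in> V)"
proof
  assume "F2_subspace n V"
  then have "submodule class_ring V (module_vec TYPE(bit) n)"
    by (rule VectorSpace.subspace.submod)
  then show "V \<subseteq> F2_space n \<and> 0\<^sub>v n \<in> V \<and> (\<forall>u\<in>V. \<forall>v\<in>V. u + v \<in> V)"
    unfolding submodule_def by (auto simp: module_vec_simps)
next
  assume V: "V \<subseteq> F2_space n \<and> 0\<^sub>v n \<in> V \<and> (\<forall>u\<in>V. \<forall>v\<in>V. u + v \<in> V)"
  have smult: "c \<cdot>\<^sub>v v \<in> V" if "v \<in> V" for c :: bit and v
  proof (cases c)
    case zero
    moreover have "0 \<cdot>\<^sub>v v = 0\<^sub>v n"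
      using V that by (intro eq_vecI) auto
    ultimately show ?thesis using V by simp
  next
    case one
    then show ?thesis using that by simp
  qed
  have "submodule class_ring V (module_vec TYPE(bit) n)"
    unfolding submodule_def
    using V smult vec_module
    by (auto simp: module_vec_simps class_ring_simps)
  then show "F2_subspace n V"
    unfolding VectorSpace.subspace_def using vec_vs by blast
qed

lemma F2_add_self:
  assumes "(v :: bit vec) \<in> F2_space n"
  shows "v + v = 0\<^sub>v n"
  using assms by (intro eq_vecI) auto

lemma F2_add_self_left:
  assumes "(u :: bit vec) \<in> F2_space n" "v \<in> F2_space n"
  shows "u + (u + v) = v"
  using assms by (simp add: assoc_add_vec[symmetric, of u n u v] F2_add_self)

lemma F2_add_cancel:
  assumes "(u :: bit vec) \<in> F2_space n" "v \<in> F2_space n" "w \<in> F2_space n" "u + v = u + w"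
  shows "v = w"
  using assms F2_add_self_left by metis

lemma F2_subspace_set_plus_self:
  assumes "F2_subspace n V"
  shows "V + V = V"
proof
  show "V + V \<subseteq> V"
    using assms by (auto simp: F2_subspace_iff elim!: set_plus_elim)
  show "V \<subseteq> V + V"
  proof
    fix v assume v: "v \<in> V"
    then have "v + 0\<^sub>v n = v" "0\<^sub>v n \<in> V"
      using assms by (auto simp: F2_subspace_iff)
    with v show "v \<in> V + V" by (metis set_plus_intro)
  qed
qed

lemma F2_subspace_Int:
  assumes "F2_subspace n U" "F2_subspace n V"
  shows "F2_subspace n (U \<inter> V)"
  using assms by (auto simp: F2_subspace_iff)

lemma F2_subspace_finite:
  assumes "F2_subspace n V"
  shows "finite V"
  using assms finite_F2_space finite_subset by (auto simp: F2_subspace_iff)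

text \<open>In characteristic 2 the span of \<open>W\<close> and \<open>v\<close> consists of just
  the two cosets \<open>W\<close> and \<open>v + W\<close>. They are disjoint because a common point
  would put \<open>v\<close> in \<open>W\<close>, and translation by \<open>v\<close> is
  injective.\<close>

lemma F2_subspace_extend:
  assumes W: "F2_subspace n W" and v: "v \<in> F2_space n" "v \<notin> W"
  shows "F2_subspace n (W \<union> (+) v ` W)" "card (W \<union> (+) v ` W) = 2 * card W"
proof -
  have Wc: "W \<subseteq> F2_space n" and W0: "0\<^sub>v n \<in> W"
    and Wadd: "\<And>x y. x \<in> W \<Longrightarrow> y \<in> W \<Longrightarrow> x + y \<in> W"
    using W by (auto simp: F2_subspace_iff)
  have 1: "x + (v + y) = v + (x + y)" if "x \<in> W" "y \<in> W" for x y
  proof -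
    have c: "x \<in> F2_space n" "y \<in> F2_space n" using that Wc by auto
    show ?thesis
      using v c by (intro eq_vecI) auto
  qed
  have 2: "v + x + y = v + (x + y)" if "x \<in> W" "y \<in> W" for x y
    using that Wc v by (meson assoc_add_vec subsetD)
  have 3: "v + x + (v + y) = x + y" if "x \<in> W" "y \<in> W" for x y
  proof -
    have c: "x \<in> F2_space n" "y \<in> F2_space n" using that Wc by auto
    have "v + x + (v + y) = v + (v + (x + y))"
      using that c v 1[OF that] assoc_add_vec[of v n x "v + y"] by simp
    then show ?thesis
      using F2_add_self_left[OF v(1), of "x + y"] c by simp
  qed
  show "F2_subspace n (W \<union> (+) v ` W)"
    unfolding F2_subspace_iff
    using Wc W0 v Wadd by (auto simp: 1 2 3)
  have "inj_on ((+) v) W"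
    using F2_add_cancel[OF v(1)] Wc by (meson inj_onI subsetD)
  moreover have "W \<inter> (+) v ` W = {}"
  proof (rule ccontr)
    assume "W \<inter> (+) v ` W \<noteq> {}"
    then obtain x where x: "x \<in> W" "v + x \<in> W" by auto
    then have "x + (v + x) \<in> W" using Wadd by blast
    moreover have "x + (v + x) = v"
      using x Wc v comm_add_vec[of v n x] F2_add_self_left[of x n v] by auto
    ultimately show False using v by simp
  qed
  ultimately show "card (W \<union> (+) v ` W) = 2 * card W"
    using F2_subspace_finite[OF W] by (simp add: card_Un_disjoint card_image)
qed

lemma card_F2_subspace:
  assumes V: "F2_subspace n V"
  obtains k where "card V = 2 ^ k"
proof -
  define P where "P W \<longleftrightarrow> F2_subspace n W \<and> W \<subseteq> V \<and> (\<exists>k. card W = 2 ^ k)" for W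
  have "P {0\<^sub>v n}"
    using V unfolding P_def by (auto simp: F2_subspace_iff intro: exI[of _ 0])
  moreover have "\<forall>W. P W \<longrightarrow> card W < Suc (card V)"
    using F2_subspace_finite[OF V] by (auto simp: P_def less_Suc_eq_le intro: card_mono)
  ultimately obtain W where W: "P W" and max: "\<And>U. P U \<Longrightarrow> card U \<le> card W"
    using ex_has_greatest_nat[of P _ card "Suc (card V)"] by (meson less_imp_le)
  obtain k where k: "card W = 2 ^ k" using W by (auto simp: P_def)
  have sub: "F2_subspace n W" "W \<subseteq> V" using W by (auto simp: P_def)
  have "V \<subseteq> W"
  proof
    fix v assume v: "v \<in> V"
    show "v \<in> W"
    proof (rule ccontr)
      assume "v \<notin> W"
      moreover have "v \<in> F2_space n" using V v by (auto simp: F2_subspace_iff)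
      ultimately have ext: "F2_subspace n (W \<union> (+) v ` W)"
        and c: "card (W \<union> (+) v ` W) = 2 ^ Suc k"
        using F2_subspace_extend[OF sub(1)] k by auto
      have "W \<union> (+) v ` W \<subseteq> V"
        using V v sub by (auto simp: F2_subspace_iff)
      with ext c have "P (W \<union> (+) v ` W)" unfolding P_def by blast
      from max[OF this] show False using c k by simp
    qed
  qed
  with sub(2) k that show thesis by simp
qed

text \<open>Addition maps \<open>(V \<inter> H) \<times> (V \<inter> K)\<close> into
  \<open>V\<close>, and it is injective because \<open>H\<close> and \<open>K\<close> meet only in
  zero.\<close>

lemma card_Int_mult_le:
  assumes V: "F2_subspace n V" and H: "F2_subspace n H" and K: "F2_subspace n K"
    and HK: "H \<inter> K = {0\<^sub>v n}"
  shows "card (V \<inter> H) * card (V \<inter> K) \<le> card V"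
proof -
  have c: "V \<subseteq> F2_space n" "H \<subseteq> F2_space n" "K \<subseteq> F2_space n"
    using V H K by (auto simp: F2_subspace_iff)
  have "inj_on (\<lambda>(h, k). h + k) ((V \<inter> H) \<times> (V \<inter> K))"
  proof (rule inj_onI, clarify)
    fix h k h' k'
    assume h: "h \<in> H" "h' \<in> H" and k: "k \<in> K" "k' \<in> K" and eq: "h + k = h' + k'"
    have cs: "h \<in> F2_space n" "h' \<in> F2_space n" "k \<in> F2_space n" "k' \<in> F2_space n"
      using h k c by auto
    \<comment> \<open>Adding \<open>h'\<close> and \<open>k\<close> to both sides of
      \<open>h + k = h' + k'\<close> separates the two subspaces: the common value
      \<open>h' + h = k' + k\<close> lies in \<open>H \<inter> K\<close>, hence is zero.\<close>
    have "h' + h = h' + (h + k + k)"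
      using cs by (simp add: assoc_add_vec[of h n k k] F2_add_self)
    also have "\<dots> = h' + (h' + (k' + k))"
      using cs by (simp add: eq assoc_add_vec[of h' n k' k])
    also have "\<dots> = k' + k"
      using cs by (intro F2_add_self_left) auto
    finally have "h' + h = k' + k" .
    moreover have "h' + h \<in> H" "k' + k \<in> K"
      using h k H K by (auto simp: F2_subspace_iff)
    ultimately have "h' + h = 0\<^sub>v n" "k' + k = 0\<^sub>v n"
      using HK by auto
    then show "h = h' \<and> k = k'"
      using cs F2_add_cancel F2_add_self by metis
  qed
  moreover have "(\<lambda>(h, k). h + k) ` ((V \<inter> H) \<times> (V \<inter> K)) \<subseteq> V"
    using V by (auto simp: F2_subspace_iff)
  ultimately show ?thesis
    using card_inj_on_le F2_subspace_finite[OF V] by (metis card_cartesian_product)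
qed

section \<open>Covering by cosets\<close>

lemma coset_cover_num_le:
  assumes "F2_subspace n V" "S \<subseteq> F2_space n" "T \<subseteq> F2_space n" "S \<subseteq> T + V"
  shows "coset_cover_num n V S \<le> card T"
  unfolding coset_cover_num_def
  using coset_cover_num_set(1)[OF assms(1,2)] assms(3,4) by (intro Min_le) auto

text \<open>A coset of \<open>V\<close> meets \<open>H\<close> either nowhere or in a coset of
  \<open>V \<inter> H\<close>. Summing this bound over the cosets of an optimal cover gives the
  claim.\<close>

lemma card_le_coset_cover_num_mult:
  assumes V: "F2_subspace n V" and H: "F2_subspace n H"
  shows "card H \<le> coset_cover_num n V H * card (V \<inter> H)"
proof -
  have Hc: "H \<subseteq> F2_space n" and Vc: "V \<subseteq> F2_space n"
    using V H by (auto simp: F2_subspace_iff)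
  obtain T where T: "T \<subseteq> F2_space n" "H \<subseteq> T + V" "coset_cover_num n V H = card T"
    using Min_in[OF coset_cover_num_set[OF V Hc]] unfolding coset_cover_num_def by auto
  have finT: "finite T" using T(1) finite_F2_space finite_subset by blast
  have fin: "finite (V \<inter> H)" using F2_subspace_finite[OF V] by simp
  have coset: "card (H \<inter> (+) s ` V) \<le> card (V \<inter> H)" if s: "s \<in> T" for s
  proof (cases "H \<inter> (+) s ` V = {}")
    case False
    then obtain w where w: "w \<in> V" "s + w \<in> H" by auto
    have sc: "s \<in> F2_space n" "w \<in> F2_space n" using s T w Vc by auto
    \<comment> \<open>Translation by a point \<open>s + w\<close> of the intersection keeps
      \<open>H\<close> fixed and cancels \<open>s\<close>, so it carries the intersection into
      \<open>V \<inter> H\<close>.\<close>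
    have "inj_on ((+) (s + w)) (H \<inter> (+) s ` V)"
      using F2_add_cancel w Hc by (meson IntD1 inj_onI subsetD)
    moreover have "(+) (s + w) ` (H \<inter> (+) s ` V) \<subseteq> V \<inter> H"
    proof clarify
      fix x assume x: "x \<in> V" "s + x \<in> H"
      have xc: "x \<in> F2_space n" using x Vc by auto
      have "s + w + (s + x) = w + x"
        using sc xc F2_add_self_left[of s n x] comm_add_vec[of s n w]
        by (simp add: assoc_add_vec[of w n s])
      moreover have "s + w + (s + x) \<in> H" "w + x \<in> V"
        using x w H V by (auto simp: F2_subspace_iff)
      ultimately show "s + w + (s + x) \<in> V \<inter> H" by simp
    qed
    ultimately show ?thesis using card_inj_on_le fin by blast
  qed simp
  have "H \<subseteq> (\<Union>s\<in>T. H \<inter> (+) s ` V)"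
    using T(2) by (fastforce elim: set_plus_elim)
  then have "card H \<le> card (\<Union>s\<in>T. H \<inter> (+) s ` V)"
    using finT F2_subspace_finite[OF H] by (intro card_mono) auto
  also have "\<dots> \<le> (\<Sum>s\<in>T. card (H \<inter> (+) s ` V))"
    using finT by (rule card_UN_le)
  also have "\<dots> \<le> card T * card (V \<inter> H)"
    using sum_bounded_above[of T, OF coset] by simp
  finally show ?thesis using T(3) by simp
qed

text \<open>The exponents of \<open>card (V \<inter> H)\<close> and
  \<open>card (V \<inter> K)\<close> sum to at most \<open>t\<close>, so one of them is at most
  \<open>t div 2\<close>, and the corresponding subspace needs many cosets. Here
  \<open>t - t div 2\<close> is the ceiling of t/2.\<close>

lemma max_coset_cover_num_ge:
  assumes V: "F2_subspace n V" and H: "F2_subspace n H" and K: "F2_subspace n K"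
    and HK: "H \<inter> K = {0\<^sub>v n}"
    and card: "card H = 2 ^ t" "card K = 2 ^ t" "card V \<le> 2 ^ t"
  shows "2 ^ (t - t div 2) \<le> max (coset_cover_num n V H) (coset_cover_num n V K)"
proof -
  have bound: "2 ^ (t - t div 2) \<le> coset_cover_num n V S"
    if S: "F2_subspace n S" "card S = 2 ^ t" and i: "card (V \<inter> S) = 2 ^ i" "i \<le> t div 2" for S i
  proof -
    have "(2::nat) ^ (t - t div 2) * 2 ^ (t div 2) = 2 ^ t"
      by (simp flip: power_add)
    also have "\<dots> \<le> coset_cover_num n V S * 2 ^ i"
      using card_le_coset_cover_num_mult[OF V S(1)] S(2) i(1) by simp
    also have "\<dots> \<le> coset_cover_num n V S * 2 ^ (t div 2)"
      using i(2) by (intro mult_left_mono power_increasing) auto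
    finally show ?thesis by simp
  qed
  obtain i where i: "card (V \<inter> H) = 2 ^ i"
    using card_F2_subspace[OF F2_subspace_Int[OF V H]] .
  obtain j where j: "card (V \<inter> K) = 2 ^ j"
    using card_F2_subspace[OF F2_subspace_Int[OF V K]] .
  have "(2::nat) ^ (i + j) \<le> 2 ^ t"
    using card_Int_mult_le[OF V H K HK] card(3) i j by (simp add: power_add)
  then have "i + j \<le> t" by simp
  then consider "i \<le> t div 2" | "j \<le> t div 2" by linarith
  then show ?thesis
    using bound[OF H card(1) i] bound[OF K card(2) j] by cases auto
qed

section \<open>Coordinate subspaces\<close>

text \<open>The span of the unit vectors indexed by \<open>A\<close>. Indices from \<open>n\<close>
  on have no effect, so counting by \<open>card A\<close> requires
  \<open>A \<subseteq> {..<n}\<close>.\<close>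

definition coord_space :: "nat \<Rightarrow> nat set \<Rightarrow> bit vec set" where
  "coord_space n A = {v \<in> F2_space n. \<forall>i<n. i \<notin> A \<longrightarrow> v $ i = 0}"

lemma F2_subspace_coord_space: "F2_subspace n (coord_space n A)"
  by (auto simp: F2_subspace_iff coord_space_def)

text \<open>A binary vector is the indicator of its support, and the supports range over all subsets
  of \<open>A\<close>.\<close>

lemma card_coord_space:
  assumes "A \<subseteq> {..<n}"
  shows "card (coord_space n A) = 2 ^ card A"
proof -
  have "bij_betw (\<lambda>v. {i. i < n \<and> v $ i = 1}) (coord_space n A) (Pow A)"
    by (rule bij_betw_byWitness[where f' = "\<lambda>B. vec n (\<lambda>i. if i \<in> B then 1 else 0)"])
      (use assms in \<open>auto simp: coord_space_def intro!: eq_vecI split: if_splits\<close>)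
  then show ?thesis
    using assms by (simp add: bij_betw_same_card card_Pow finite_subset[OF assms])
qed

text \<open>Each vector splits into its part off \<open>C\<close>, which serves as coset
  representative, and its part on \<open>C\<close>, which the subspace absorbs.\<close>

lemma coord_space_subset_plus:
  "coord_space n A \<subseteq> coord_space n (A - C) + coord_space n C"
proof
  fix v assume v: "v \<in> coord_space n A"
  let ?u = "vec n (\<lambda>i. if i \<in> C then 0 else v $ i)"
  let ?w = "vec n (\<lambda>i. if i \<in> C then v $ i else 0)"
  have "v = ?u + ?w"
    using v by (intro eq_vecI) (auto simp: coord_space_def)
  moreover have "?u \<in> coord_space n (A - C)" "?w \<in> coord_space n C"
    using v by (auto simp: coord_space_def)
  ultimately show "v \<in> coord_space n (A - C) + coord_space n C"
    unfolding set_plus_def by blast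
qed

lemma coset_cover_num_coord_space_le:
  assumes "A \<subseteq> {..<n}"
  shows "coset_cover_num n (coord_space n C) (coord_space n A) \<le> 2 ^ card (A - C)"
proof -
  have "A - C \<subseteq> {..<n}" using assms by auto
  then show ?thesis
    using coset_cover_num_le[OF F2_subspace_coord_space _ _ coord_space_subset_plus]
    by (metis F2_subspace_coord_space F2_subspace_iff card_coord_space)
qed

section \<open>The extremal example\<close>

lemma nat_ceiling_half: "nat \<lceil>real t / 2\<rceil> = t - t div 2"
proof (cases "even t")
  case True
  then show ?thesis by (auto elim!: evenE)
next
  case False
  then obtain k where k: "t = 2 * k + 1" by (auto elim: oddE)
  have "\<lceil>real t / 2\<rceil> = int k + 1"
    unfolding k by (rule ceiling_unique) auto
  then show ?thesis using k by simp
qed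

theorem theorem2p7:
  fixes t :: nat
  assumes "t \<ge> 1"
  shows "\<exists>(n::nat) H0 H1 B.
    F2_subspace n H0 \<and> F2_subspace n H1 \<and> card H0 = card H1 \<and>
    B \<subseteq> F2_space n \<and> B \<noteq> {} \<and>
    (\<forall>H \<in> {H0, H1}.
      card (H + H) = card H \<and>
      real (card (sym_diff H B)) = (1 - 1 / 2 ^ t) * real (card H)) \<and>
    Min {max (coset_cover_num n V H0) (coset_cover_num n V H1) | V.
           F2_subspace n V \<and> card V \<le> card H0}
      = 2 ^ nat \<lceil>real t / 2\<rceil>"
proof -
  define n where "n = 2 * t"
  define H0 where "H0 = coord_space n {..<t}"
  define H1 where "H1 = coord_space n {t..<n}"
  \<comment> \<open>\<open>C\<close> takes \<open>t - t div 2\<close> coordinates from the block of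
    \<open>H0\<close> and \<open>t div 2\<close> from the block of \<open>H1\<close>. The total is
    exactly \<open>t\<close>, the largest dimension allowed for \<open>V\<close>.\<close>
  define C where "C = {..<t - t div 2} \<union> {t..<t + t div 2}"
  define V where "V = coord_space n C"
  let ?M = "{max (coset_cover_num n V H0) (coset_cover_num n V H1) | V.
    F2_subspace n V \<and> card V \<le> card H0}"
  have sub: "F2_subspace n H0" "F2_subspace n H1" "F2_subspace n V"
    by (simp_all add: H0_def H1_def V_def F2_subspace_coord_space)
  have card: "card H0 = 2 ^ t" "card H1 = 2 ^ t"
    by (simp_all add: H0_def H1_def n_def card_coord_space subset_eq)
  have "card C = t"
    unfolding C_def by (subst card_Un_disjoint) auto
  then have cardV: "card V = 2 ^ t"
    unfolding V_def by (subst card_coord_space) (auto simp: C_def n_def)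
  have int: "H0 \<inter> H1 = {0\<^sub>v n}"
    by (auto simp: H0_def H1_def coord_space_def intro!: eq_vecI)
  \<comment> \<open>Since zero lies in \<open>H\<close>, the symmetric difference only removes that
    one point.\<close>
  have sd: "card (sym_diff H {0\<^sub>v n}) = 2 ^ t - 1" if "F2_subspace n H" "card H = 2 ^ t" for H
  proof -
    have "sym_diff H {0\<^sub>v n} = H - {0\<^sub>v n}" "0\<^sub>v n \<in> H"
      using that by (auto simp: F2_subspace_iff)
    then show ?thesis using that by simp
  qed
  \<comment> \<open>The coordinates of each block missing from \<open>C\<close> index the coset
    representatives: \<open>t div 2\<close> of them for \<open>H0\<close> and
    \<open>t - t div 2\<close> for \<open>H1\<close>.\<close>
  have "{..<t} - C = {t - t div 2..<t}" "{t..<n} - C = {t + t div 2..<n}"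
    by (auto simp: C_def n_def)
  then have "coset_cover_num n V H0 \<le> 2 ^ (t div 2)"
    "coset_cover_num n V H1 \<le> 2 ^ (t - t div 2)"
    using coset_cover_num_coord_space_le[of "{..<t}" n C]
      coset_cover_num_coord_space_le[of "{t..<n}" n C]
    by (auto simp: subset_eq V_def H0_def H1_def n_def)
  moreover have "(2::nat) ^ (t div 2) \<le> 2 ^ (t - t div 2)"
    by (rule power_increasing) auto
  ultimately have "max (coset_cover_num n V H0) (coset_cover_num n V H1) \<le> 2 ^ (t - t div 2)"
    by (meson le_trans max.boundedI)
  \<comment> \<open>The lower bound for arbitrary subspaces applies to this \<open>V\<close> as
    well, which turns the estimate into an equality.\<close>
  with max_coset_cover_num_ge[OF sub(3,1,2) int card] cardV
  have attained: "max (coset_cover_num n V H0) (coset_cover_num n V H1) = 2 ^ (t - t div 2)"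
    by (intro antisym) auto
  have "?M \<subseteq> (\<lambda>V. max (coset_cover_num n V H0) (coset_cover_num n V H1)) ` Pow (F2_space n)"
    by (auto simp: F2_subspace_iff)
  then have "finite ?M"
    using finite_F2_space finite_subset by blast
  moreover have "2 ^ (t - t div 2) \<le> m" if "m \<in> ?M" for m
    using that max_coset_cover_num_ge[OF _ sub(1,2) int card] card by auto
  moreover have "2 ^ (t - t div 2) \<in> ?M"
    by (intro CollectI exI[of _ V] conjI) (simp_all add: attained sub card cardV)
  ultimately have "Min ?M = 2 ^ nat \<lceil>real t / 2\<rceil>"
    unfolding nat_ceiling_half by (rule Min_eqI)
  \<comment> \<open>The subtraction on the left is on naturals; it is exact because 2 ^ t is at
    least 1.\<close>
  moreover have "real (2 ^ t - 1) = (1 - 1 / 2 ^ t) * 2 ^ t"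
    by (simp add: field_simps of_nat_diff)
  ultimately show ?thesis
    using sub card sd
    by (intro exI[of _ n] exI[of _ H0] exI[of _ H1] exI[of _ "{0\<^sub>v n}"])
      (auto simp: F2_subspace_set_plus_self)
qed

end
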